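(* Let $\lambda = (\lambda_1,\dots,\lambda_n)\in\mathbb{Z}_+^n$. If the rectangular simplex $\Delta(\lambda)$ has the $\mathrm{LPE}(n)$ property, then $\Delta(\lambda)$ is almost 1-normal.
   Context: $\mathbb{Z}_+$ is the set of positive integers. The rectangular simplex $\Delta(\lambda) \subset \mathbb{R}^n$ is the convex hull of $\{0,\lambda_1 e_1,\dots,\lambda_n e_n\}$. For $k\in\mathbb{Z}_+$, a lattice polytope has the $\mathrm{LPE}(k)$ property if each of its edges contains at least $k$ lattice points (endpoints included). Let $L = \operatorname{lcm}(\lambda_1,\dots,\lambda_n)$, $L_i = L/\lambda_i$ and $d = \gcd(L_1,\dots,L_n)$. $\Delta(\lambda)$ is almost 1-normal (A1N) if $L-d$ is in the semigroup generated by the $L_i$, i.e. is a linear combination of $L_1,\dots,L_n$ with non-negative integer coefficients. *)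

theory Defs
  imports "HOL-Analysis.Analysis"
begin

text \<open>
  The dimension \<open>n\<close> is \<open>CARD('n)\<close>, hence at least 1, and an element of
  \<open>\<int>\<^sub>+\<^sup>n\<close> is a function \<open>'n \<Rightarrow> nat\<close> with positive values.
\<close>

definition rectangular_simplex :: "('n::finite \<Rightarrow> nat) \<Rightarrow> (real ^ 'n) set" where
  "rectangular_simplex lam =
     convex hull (insert 0 (range (\<lambda>i. real (lam i) *\<^sub>R axis i 1)))"

definition lattice_points :: "(real ^ 'n::finite) set" where
  "lattice_points = {x. \<forall>i. x $ i \<in> \<int>}"

definition lattice_polytope :: "(real ^ 'n::finite) set \<Rightarrow> bool" where
  "lattice_polytope P \<longleftrightarrow> (\<exists>V. finite V \<and> V \<subseteq> lattice_points \<and> P = convex hull V)"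

text \<open>
  The property is meant for lattice polytopes \<open>P\<close>. Their edges are bounded, so the set
  whose cardinality is taken is finite and \<open>card\<close> has its usual meaning.
\<close>

definition LPE :: "nat \<Rightarrow> (real ^ 'n::finite) set \<Rightarrow> bool" where
  "LPE k P \<longleftrightarrow> (\<forall>F. F edge_of P \<longrightarrow> k \<le> card (F \<inter> lattice_points))"

lemma lattice_polytope_rectangular_simplex: "lattice_polytope (rectangular_simplex lam)"
  unfolding lattice_polytope_def rectangular_simplex_def
  by (rule exI[of _ "insert 0 (range (\<lambda>i. real (lam i) *\<^sub>R axis i 1))"])
     (auto simp: lattice_points_def axis_def)

definition lam_lcm :: "('n::finite \<Rightarrow> nat) \<Rightarrow> nat" where
  "lam_lcm lam = Lcm (range lam)"

definition lam_quot :: "('n::finite \<Rightarrow> nat) \<Rightarrow> 'n \<Rightarrow> nat" where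
  "lam_quot lam i = lam_lcm lam div lam i"

definition lam_gcd :: "('n::finite \<Rightarrow> nat) \<Rightarrow> nat" where
  "lam_gcd lam = Gcd (range (lam_quot lam))"

text \<open>
  The property of \<open>\<Delta>(\<lambda>)\<close> is expressed through \<open>\<lambda>\<close>, which the simplex determines.
  For positive \<open>\<lambda>\<close> the division above is exact and \<open>d \<le> L\<close>, so the subtraction
  below does not truncate.
\<close>

definition almost_1_normal :: "('n::finite \<Rightarrow> nat) \<Rightarrow> bool" where
  "almost_1_normal lam \<longleftrightarrow>
     (\<exists>c :: 'n \<Rightarrow> nat. lam_lcm lam - lam_gcd lam = (\<Sum>i\<in>UNIV. c i * lam_quot lam i))"

lemma lam_gcd_le_lam_lcm:
  fixes lam :: "'n::finite \<Rightarrow> nat"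
  assumes "\<And>i. lam i > 0"
  shows "lam_gcd lam \<le> lam_lcm lam"
proof -
  fix i :: 'n
  have pos: "lam_lcm lam > 0"
    unfolding lam_lcm_def using assms
    by (metis Lcm_0_iff_nat finite_imageI finite rangeE gr0I less_irrefl)
  have "lam_quot lam i * lam i = lam_lcm lam"
    by (simp add: lam_quot_def lam_lcm_def)
  then have "lam_quot lam i dvd lam_lcm lam"
    by (metis dvd_triv_left)
  moreover have "lam_gcd lam dvd lam_quot lam i"
    by (simp add: lam_gcd_def)
  ultimately show ?thesis
    using pos by (meson dvd_imp_le dvd_trans)
qed

end

theory Submission
  imports Defs
begin

text \<open>
  Write \<open>a i = L / \<lambda> i\<close>. By \<open>LPE(n)\<close> applied to the edges missing the origin,
  \<open>gcd (\<lambda> i) (\<lambda> j) \<ge> n - 1\<close>, that is, \<open>(n - 1) * lcm (a i) (a j) \<le> L\<close> for \<open>i \<noteq> j\<close>.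
  Fix an index \<open>k\<close>. As in Brauer's bound for the Frobenius number, the multiple \<open>L - d\<close> of \<open>d\<close>
  is an integer combination of the \<open>a i\<close> in which every coefficient \<open>c i\<close> with \<open>i \<noteq> k\<close>
  is reduced so that \<open>0 \<le> c i\<close> and \<open>(c i + 1) * a i \<le> lcm (a k) (a i)\<close>. Summing the
  \<open>n - 1\<close> upper bounds leaves more than \<open>- a k\<close> for the last term, so \<open>c k \<ge> 0\<close> as well.
\<close>

section \<open>Integer combinations with reduced coefficients\<close>

text \<open>Bezout gives some coefficient of \<open>b\<close>, and it matters only modulo
  \<open>q = g div gcd g b\<close>, because \<open>q * b = lcm g b\<close> is a multiple of
  \<open>g\<close>. Its remainder is at most \<open>q - 1\<close>, whence the bound on
  \<open>c + 1\<close>.\<close>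

lemma reduced_coefficient_exists:
  fixes N :: int and g b :: nat
  assumes "g > 0" "b > 0" "int (gcd g b) dvd N"
  obtains c where "0 \<le> c" "(c + 1) * int b \<le> int (lcm g b)" "int g dvd N - c * int b"
proof -
  define q where "q = g div gcd g b"
  have g: "g = q * gcd g b"
    by (simp add: q_def)
  have q0: "q > 0"
    using assms(1) g by (metis gr0I mult_0)
  have qb: "q * b = lcm g b"
    using assms(1) by (simp add: q_def lcm_nat_def div_mult_swap mult.commute)
  obtain u v :: int where uv: "u * int g + v * int b = int (gcd g b)"
    by (metis bezout_int gcd_int_int_eq)
  obtain k where k: "N = int (gcd g b) * k"
    using assms(3) by (elim dvdE)
  define c where "c = (k * v) mod int q"
  have "int g dvd int q * int b"
    unfolding of_nat_mult[symmetric] qb by simp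
  moreover have "N - c * int b = int g * (k * u) + (k * v div int q) * (int q * int b)"
  proof -
    have c: "c = k * v - int q * (k * v div int q)"
      by (simp add: c_def minus_mult_div_eq_mod)
    have "N = (u * int g + v * int b) * k"
      by (simp only: uv k)
    then show ?thesis
      unfolding c by (simp add: algebra_simps)
  qed
  ultimately have "int g dvd N - c * int b"
    by simp
  moreover have "0 \<le> c" "c + 1 \<le> int q"
    using q0 by (simp_all add: c_def zless_imp_add1_zle)
  moreover from this have "(c + 1) * int b \<le> int q * int b"
    by (intro mult_right_mono) auto
  ultimately show ?thesis
    using that qb by (metis of_nat_mult)
qed

text \<open>Induction on \<open>T\<close>: the coefficient of a new index \<open>j\<close> is
  reduced modulo the gcd \<open>g\<close> of the earlier values, and \<open>g\<close> divides what
  remains of \<open>N\<close>, so the induction hypothesis applies to it. The bound by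
  \<open>lcm g (a j)\<close> weakens to \<open>lcm (a k) (a j)\<close> since \<open>g\<close>
  divides \<open>a k\<close>.\<close>

lemma reduced_combination_exists:
  fixes a :: "'i \<Rightarrow> nat" and N :: int
  assumes "finite T" "k \<notin> T" "\<And>i. a i > 0" "int (Gcd (a ` insert k T)) dvd N"
  shows "\<exists>c. N = (\<Sum>i\<in>insert k T. c i * int (a i)) \<and>
             (\<forall>i\<in>T. 0 \<le> c i \<and> (c i + 1) * int (a i) \<le> int (lcm (a k) (a i)))"
  using assms(1,2,4)
proof (induction T arbitrary: N rule: finite_induct)
  case empty
  then obtain m where "N = int (a k) * m"
    by (auto elim: dvdE)
  then show ?case
    by (intro exI[of _ "\<lambda>_. m"]) (simp add: mult.commute)
next
  case (insert j T)
  define g where "g = Gcd (a ` insert k T)"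
  have gk: "g dvd a k"
    by (simp add: g_def)
  then have g0: "g > 0"
    using assms(3)[of k] by (metis dvd_0_left_iff gr0I less_irrefl)
  have "Gcd (a ` insert k (insert j T)) = gcd g (a j)"
    by (simp add: g_def gcd.commute gcd.left_commute)
  with insert.prems have "int (gcd g (a j)) dvd N"
    by metis
  then obtain cj where cj: "0 \<le> cj" "(cj + 1) * int (a j) \<le> int (lcm g (a j))"
      "int g dvd N - cj * int (a j)"
    using reduced_coefficient_exists[OF g0 assms(3)[of j]] by blast
  have "lcm g (a j) \<le> lcm (a k) (a j)"
    using gk assms(3) by (intro dvd_imp_le lcm_mono) (auto simp: lcm_pos_nat)
  with cj(2) have bound: "(cj + 1) * int (a j) \<le> int (lcm (a k) (a j))"
    by linarith
  obtain c where c: "N - cj * int (a j) = (\<Sum>i\<in>insert k T. c i * int (a i))"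
      "\<forall>i\<in>T. 0 \<le> c i \<and> (c i + 1) * int (a i) \<le> int (lcm (a k) (a i))"
    using insert.IH[of "N - cj * int (a j)"] insert.prems cj(3) by (auto simp: g_def)
  have jk: "j \<notin> insert k T"
    using insert by auto
  have "(\<Sum>i\<in>insert k T. (c(j := cj)) i * int (a i)) = (\<Sum>i\<in>insert k T. c i * int (a i))"
    using jk by (intro sum.cong) auto
  then have "(\<Sum>i\<in>insert j (insert k T). (c(j := cj)) i * int (a i)) = N"
    using jk insert.hyps(1) c(1) by (subst sum.insert) auto
  then have "N = (\<Sum>i\<in>insert k (insert j T). (c(j := cj)) i * int (a i))"
    by (simp only: insert_commute)
  moreover have "\<forall>i\<in>insert j T. 0 \<le> (c(j := cj)) i \<and>
      ((c(j := cj)) i + 1) * int (a i) \<le> int (lcm (a k) (a i))"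
    using c(2) cj(1) bound by auto
  ultimately show ?case
    by blast
qed

lemma nonneg_combination_exists:
  fixes a :: "'i \<Rightarrow> nat" and N :: nat
  assumes "finite T" "k \<notin> T" "\<And>i. a i > 0" "Gcd (a ` insert k T) dvd N"
    and less: "(\<Sum>i\<in>T. lcm (a k) (a i)) < N + (\<Sum>i\<in>insert k T. a i)"
  shows "\<exists>c :: 'i \<Rightarrow> nat. N = (\<Sum>i\<in>insert k T. c i * a i)"
proof -
  have "int (Gcd (a ` insert k T)) dvd int N"
    using assms(4) by (simp only: int_dvd_int_iff)
  then obtain c where c: "int N = (\<Sum>i\<in>insert k T. c i * int (a i))"
      "\<And>i. i \<in> T \<Longrightarrow> 0 \<le> c i" "\<And>i. i \<in> T \<Longrightarrow> (c i + 1) * int (a i) \<le> int (lcm (a k) (a i))"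
    using reduced_combination_exists[OF assms(1,2), where a = a and N = "int N"] assms(3) by blast
  have "(\<Sum>i\<in>T. c i * int (a i)) + (\<Sum>i\<in>T. int (a i)) \<le> (\<Sum>i\<in>T. int (lcm (a k) (a i)))"
    unfolding sum.distrib[symmetric] using c(3) by (intro sum_mono) (simp add: algebra_simps)
  also have "\<dots> < int (N + (\<Sum>i\<in>insert k T. a i))"
    using less by (metis of_nat_less_iff of_nat_sum)
  \<comment> \<open>Substituting for \<open>N\<close> cancels all terms over \<open>T\<close>. Both
    sides are kept as multiples of \<open>a k\<close>, so that dividing yields
    \<open>- 1 < c k\<close>.\<close>
  finally have "- 1 * int (a k) < c k * int (a k)"
    using assms(1,2) c(1) by simp
  then have "0 \<le> c k"
    using mult_right_less_imp_less[of "- 1" "int (a k)" "c k"] by simp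
  with c(2) have "\<And>i. i \<in> insert k T \<Longrightarrow> int (nat (c i)) = c i"
    by auto
  with c(1) have "int N = int (\<Sum>i\<in>insert k T. nat (c i) * a i)"
    by simp
  then show ?thesis
    by (metis of_nat_eq_iff)
qed

section \<open>Lattice points on the edges of the simplex\<close>

text \<open>The vertices other than the origin are nonzero and pairwise orthogonal. Affine
  independence makes the hull of any set of vertices a face, which provides the edges below.\<close>

lemma affine_independent_rectangular_simplex_vertices:
  fixes lam :: "'n::finite \<Rightarrow> nat"
  assumes "\<And>i. lam i > 0"
  shows "\<not> affine_dependent (insert 0 (range (\<lambda>i. real (lam i) *\<^sub>R (axis i 1 :: real ^ 'n))))"
proof -
  let ?R = "range (\<lambda>i. real (lam i) *\<^sub>R (axis i 1 :: real ^ 'n))"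
  have notin: "0 \<notin> ?R"
    using assms by (auto simp: less_imp_neq[symmetric])
  have "pairwise orthogonal ?R"
    by (auto simp: pairwise_def orthogonal_def inner_axis_axis)
  with notin have "independent ?R"
    by (intro pairwise_orthogonal_independent)
  with notin show ?thesis
    by (simp add: affine_dependent_iff_dependent)
qed

lemma edge_of_rectangular_simplex:
  fixes lam :: "'n::finite \<Rightarrow> nat"
  assumes "\<And>i. lam i > 0" "i \<noteq> j"
  shows "convex hull {real (lam i) *\<^sub>R axis i 1, real (lam j) *\<^sub>R axis j 1}
         edge_of rectangular_simplex lam"
proof -
  have "real (lam i) *\<^sub>R axis i 1 \<noteq> (real (lam j) *\<^sub>R axis j 1 :: real ^ 'n)"
  proof
    assume "real (lam i) *\<^sub>R axis i 1 = (real (lam j) *\<^sub>R axis j 1 :: real ^ 'n)"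
    then have "(real (lam i) *\<^sub>R axis i 1 :: real ^ 'n) $ i = (real (lam j) *\<^sub>R axis j 1) $ i"
      by simp
    then show False
      using assms(1)[of i] assms(2) by (simp add: axis_def)
  qed
  then have "aff_dim (convex hull {real (lam i) *\<^sub>R axis i 1,
      real (lam j) *\<^sub>R axis j 1 :: real ^ 'n}) = 1"
    by (simp add: aff_dim_convex_hull aff_dim_2)
  moreover have "convex hull {real (lam i) *\<^sub>R axis i 1, real (lam j) *\<^sub>R axis j 1}
      face_of rectangular_simplex lam"
    unfolding rectangular_simplex_def
    by (subst face_of_convex_hull_affine_independent
          [OF affine_independent_rectangular_simplex_vertices[OF assms(1)]])
       (intro exI conjI refl, auto)
  ultimately show ?thesis
    by (simp add: edge_of_def)
qed

lemma card_lattice_points_edge_le: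
  fixes lam :: "'n::finite \<Rightarrow> nat"
  assumes pos: "\<And>i. lam i > 0" and "i \<noteq> j"
  shows "card (convex hull {real (lam i) *\<^sub>R axis i 1, real (lam j) *\<^sub>R axis j 1} \<inter>
           (lattice_points :: (real ^ 'n) set)) \<le> gcd (lam i) (lam j) + 1"
    (is "card ?E \<le> ?g + 1")
proof -
  \<comment> \<open>The points \<open>f 0, ..., f ?g\<close> cut the segment into \<open>?g\<close>
    equal parts. Covering the lattice points by them suffices, as \<open>LPE\<close> bounds their
    number from below.\<close>
  define f where "f m = (real m / real ?g) *\<^sub>R (real (lam i) *\<^sub>R axis i 1) +
      (1 - real m / real ?g) *\<^sub>R (real (lam j) *\<^sub>R (axis j 1 :: real ^ 'n))" for m :: nat
  have g0: "?g > 0"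
    using pos[of i] by simp
  have "?E \<subseteq> f ` {..?g}"
  proof
    fix x assume x: "x \<in> ?E"
    then obtain t s where ts: "0 \<le> t" "0 \<le> s" "t + s = 1"
      and xts: "x = t *\<^sub>R (real (lam i) *\<^sub>R axis i 1) + s *\<^sub>R (real (lam j) *\<^sub>R axis j 1)"
      by (auto simp: convex_hull_2)
    have "x $ i = t * real (lam i)" "x $ j = s * real (lam j)"
      using assms(2) by (auto simp: xts axis_def)
    moreover have "x $ i \<in> \<int>" "x $ j \<in> \<int>"
      using x by (auto simp: lattice_points_def)
    ultimately obtain p q :: int where p: "t * real (lam i) = of_int p"
      and q: "s * real (lam j) = of_int q"
      by (metis Ints_cases)
    obtain u v :: int where uv: "u * int (lam i) + v * int (lam j) = int ?g"
      by (metis bezout_int gcd_int_int_eq)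
    \<comment> \<open>By Bezout, \<open>t\<close> is a multiple of \<open>1 / gcd\<close>.\<close>
    define m where "m = u * p + v * (int (lam j) - q)"
    \<comment> \<open>Since \<open>t = 1 - s\<close>, the product of \<open>t\<close> with
      \<open>lam j\<close> is an integer too, so Bezout can combine both products.\<close>
    have q': "t * real (lam j) = real (lam j) - of_int q"
    proof -
      have "t * real (lam j) = (t + s) * real (lam j) - s * real (lam j)"
        by (simp add: algebra_simps)
      then show ?thesis
        by (simp add: ts(3) q)
    qed
    have "t * real ?g = of_int m"
    proof -
      have "t * real ?g = t * of_int (u * int (lam i) + v * int (lam j))"
        by (simp add: uv)
      also have "\<dots> = of_int u * (t * real (lam i)) + of_int v * (t * real (lam j))"
        by (simp add: algebra_simps)
      also have "\<dots> = of_int m"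
        by (simp add: p q' m_def)
      finally show ?thesis .
    qed
    moreover have "0 \<le> t * real ?g" "t * real ?g \<le> real ?g"
      using ts by (auto intro!: mult_left_le_one_le)
    ultimately have m: "t * real ?g = real (nat m)" "nat m \<le> ?g"
      by linarith+
    then have "t = real (nat m) / real ?g" "s = 1 - t"
      using g0 ts by (simp_all only: eq_divide_eq) auto
    then have "x = f (nat m)"
      by (simp add: xts f_def)
    with m(2) show "x \<in> f ` {..?g}"
      by blast
  qed
  then have "card ?E \<le> card {..?g}"
    using surj_card_le[of "{..?g}" ?E f] by simp
  then show ?thesis
    by simp
qed

lemma LPE_imp_gcd_ge:
  fixes lam :: "'n::finite \<Rightarrow> nat"
  assumes "\<And>i. lam i > 0" "LPE k (rectangular_simplex lam)" "i \<noteq> j"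
  shows "k \<le> gcd (lam i) (lam j) + 1"
  using edge_of_rectangular_simplex[OF assms(1,3)] card_lattice_points_edge_le[OF assms(1,3)]
    assms(2) unfolding LPE_def by (meson le_trans)

section \<open>From gcds of the side lengths to the semigroup\<close>

text \<open>Passing to the complementary divisor of \<open>L\<close> reverses divisibility, so both
  quotients divide \<open>L div gcd l m\<close>, and hence so does their lcm.\<close>

lemma gcd_mult_lcm_quotients_dvd:
  fixes L l m :: nat
  assumes "l > 0" "m > 0" "l dvd L" "m dvd L"
  shows "gcd l m * lcm (L div l) (L div m) dvd L"
proof -
  have "L div x dvd L div g" if "g dvd x" "x dvd L" "x > 0" for x g :: nat
    using that by (auto elim!: dvdE simp: mult.assoc)
  then have "L div l dvd L div gcd l m" "L div m dvd L div gcd l m"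
    using assms by auto
  then have "lcm (L div l) (L div m) dvd L div gcd l m"
    by (rule lcm_least)
  then have "gcd l m * lcm (L div l) (L div m) dvd gcd l m * (L div gcd l m)"
    by (rule mult_dvd_mono[OF dvd_refl])
  also have "\<dots> = L"
    using assms by (simp add: gcd_dvdI1)
  finally show ?thesis .
qed

theorem theorem1p6:
  fixes lam :: "'n::finite \<Rightarrow> nat"
  assumes "\<And>i. lam i > 0"
    and "LPE CARD('n) (rectangular_simplex lam)"
  shows "almost_1_normal lam"
proof -
  define L where "L = lam_lcm lam"
  define d where "d = lam_gcd lam"
  define a where "a = lam_quot lam"
  have L0: "L > 0"
    unfolding L_def lam_lcm_def using assms(1)
    by (metis Lcm_0_iff_nat finite_imageI finite rangeE gr0I less_irrefl)
  have lam_dvd: "lam i dvd L" for i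
    by (simp add: L_def lam_lcm_def)
  have a_def': "a i = L div lam i" for i
    by (simp add: a_def lam_quot_def L_def)
  have a0: "a i > 0" for i
    using L0 assms(1)[of i] lam_dvd[of i] by (simp add: a_def' div_greater_zero_iff dvd_imp_le)
  have dL: "d \<le> L"
    unfolding d_def L_def using assms(1) by (rule lam_gcd_le_lam_lcm)
  have d_dvd: "d dvd a i" for i
    by (simp add: d_def lam_gcd_def a_def)
  have "a i dvd L" for i
    using lam_dvd[of i] by (auto simp: a_def' div_dvd_iff_mult)
  then have "d dvd L - d"
    using d_dvd by (meson dvd_diff_nat dvd_refl dvd_trans)
  fix k :: 'n
  define T where "T = UNIV - {k}"
  have T: "finite T" "k \<notin> T" and UNIV: "insert k T = UNIV"
    by (auto simp: T_def)
  have card_T: "card T = CARD('n) - 1"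
    by (simp add: T_def)
  have sum_le: "(\<Sum>i\<in>T. lcm (a k) (a i)) \<le> L"
  proof (cases "card T = 0")
    case False
    have "card T * lcm (a k) (a i) \<le> L" if "i \<in> T" for i
    proof -
      \<comment> \<open>An edge with \<open>gcd + 1\<close> lattice points has lattice length
        \<open>gcd\<close>; this loss of one matches \<open>card T = CARD('n) - 1\<close>.\<close>
      have "card T \<le> gcd (lam k) (lam i)"
        using LPE_imp_gcd_ge[OF assms, of k i] that T(2) card_T by fastforce
      then have "card T * lcm (a k) (a i) \<le> gcd (lam k) (lam i) * lcm (a k) (a i)"
        by (rule mult_le_mono1)
      also have "\<dots> \<le> L"
        using gcd_mult_lcm_quotients_dvd[OF assms(1) assms(1) lam_dvd lam_dvd] L0
        by (simp add: a_def' dvd_imp_le)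
      finally show ?thesis .
    qed
    \<comment> \<open>Each of the \<open>card T\<close> terms is at most an equal share of
      \<open>L\<close>; scaling by \<open>card T\<close> avoids division.\<close>
    then have "card T * (\<Sum>i\<in>T. lcm (a k) (a i)) \<le> card T * L"
      unfolding sum_distrib_left using sum_bounded_above[of T _ L] by simp
    with False show ?thesis
      by (metis gr0I mult_le_cancel1)
  qed (use T in simp)
  have less: "(\<Sum>i\<in>T. lcm (a k) (a i)) < L - d + (\<Sum>i\<in>insert k T. a i)"
  \<comment> \<open>Strictness has two sources. For \<open>n = 1\<close> the left side is empty and
    \<open>a k\<close> is positive; otherwise \<open>a k\<close> makes up for the subtracted
    \<open>d\<close>, and the remaining \<open>a i\<close> give a strict surplus.\<close>
  proof (cases "T = {}")
    case True
    then show ?thesis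
      using a0[of k] by simp
  next
    case False
    then have "(\<Sum>i\<in>T. a i) > 0"
      using T(1) a0 by (intro sum_pos) auto
    moreover have "d \<le> a k"
      using d_dvd a0 by (simp add: dvd_imp_le)
    ultimately show ?thesis
      using T sum_le dL by simp
  qed
  have gcd_dvd: "Gcd (a ` insert k T) dvd L - d"
    using \<open>d dvd L - d\<close> by (simp only: UNIV d_def lam_gcd_def a_def)
  have "\<exists>c :: 'n \<Rightarrow> nat. L - d = (\<Sum>i\<in>insert k T. c i * a i)"
    by (rule nonneg_combination_exists[OF T a0 gcd_dvd less])
  then show ?thesis
    by (simp add: UNIV almost_1_normal_def L_def d_def a_def)
qed

end
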